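(* Let $\hat a_1,\hat a_2>0$ with $\hat a_1+\hat a_2<1$, and $\hat b_1,\hat c_1\in(0,1)$. Consider the channel from levels $\{A_0,A_1,A_2,A_3\}$ to outputs $\{s_0,s_1,s_2,s_3\}$ with transition matrix $p^L_{MLC}(y|v)$ whose rows (for $v=A_0,A_1,A_2,A_3$; columns $y=s_0,s_1,s_2,s_3$) are $$(\hat a_1,\hat a_2,0,1-\hat a_1-\hat a_2),\quad (0,\hat b_1,1-\hat b_1,0),\quad (0,0,\hat c_1,1-\hat c_1),\quad (0,0,0,1).$$ Then the rate regions satisfy the strict inclusions $$\mathscr R_G^{DS}\subset\mathscr R_G^{TIN},\qquad \mathscr R_{NO}^{TIN}\subset\mathscr R_G^{TIN},\qquad \mathscr R_G^{SC}\subset\mathscr R_{NO}^{SC},$$ and the sum rates satisfy $$r_{s(G)}^{TIN}>r_{s(G)}^{DS},\quad r_{s(G)}^{TIN}>r_{s(NO)}^{TIN},\quad r_{s(G)}^{TIN}>r_{s(EO)}^{TIN},\quad r_{s(G)}^{SC}=r_{s(NO)}^{SC}=r_{s(EO)}^{SC}.$$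
   Context: A labeling $\sigma=(w_0,w_1,w_2,w_3)$, an ordering of the four 2-bit strings, maps the input $(X_1,X_2)=w_i$ to level $A_i$. Labelings: Gray $\sigma_G=(11,10,00,01)$; Natural Order $\sigma_{NO}=(11,10,01,00)$; Even Odd $\sigma_{EO}=(11,00,01,10)$. Given a labeling $\sigma$, the inputs $X_1,X_2$ are independent and uniform on $\{0,1\}$, and $Y$ has conditional law $P(Y=y|X_1=x_1,X_2=x_2)=p^L_{MLC}(y\,|\,\sigma(x_1x_2))$. Mutual informations use logarithms to base 2. Subscripts $G,NO,EO$ indicate the labeling used. TIN: $\mathscr R^{TIN}=\{(R_1,R_2):0\le R_1\le I(X_1;Y),\ 0\le R_2\le I(X_2;Y)\}$, $r_s^{TIN}=I(X_1;Y)+I(X_2;Y)$. SC: $\mathscr R^{SC}=\{(R_1,R_2):R_1,R_2\ge0,\ R_1\le I(X_1;Y|X_2),\ R_2\le I(X_2;Y|X_1),\ R_1+R_2\le I(X_1,X_2;Y)\}$, $r_s^{SC}=I(X_1,X_2;Y)$. DS (default setting, used only with Gray labeling): let $Y_1$ be the function of $Y$ obtained by merging $s_0$ with $s_1$ and $s_2$ with $s_3$ (alphabet of size 2), and $Y_2$ the function of $Y$ obtained by merging $s_1$ with $s_2$ (alphabet $\{s_0,s_{1\cup2},s_3\}$). Then $\mathscr R^{DS}=\{(R_1,R_2):0\le R_1\le I(X_1;Y_1),\ 0\le R_2\le I(X_2;Y_2)\}$ and $r_s^{DS}=I(X_1;Y_1)+I(X_2;Y_2)$. *)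

theory Defs
  imports "HOL-Probability.Probability"
begin

datatype level = A0 | A1 | A2 | A3

datatype symbol = S0 | S1 | S2 | S3

lemma UNIV_level: "UNIV = {A0, A1, A2, A3}"
  using level.exhaust by blast

lemma UNIV_symbol: "UNIV = {S0, S1, S2, S3}"
  using symbol.exhaust by blast

text \<open>
  Bits are Booleans, with \<^term>\<open>True\<close> for 1 and \<^term>\<open>False\<close> for 0.
  A labeling \<open>(w0, w1, w2, w3)\<close> is the function sending the level \<open>Ai\<close> to the string \<open>wi\<close>;
  the level that carries the input \<open>(x1, x2)\<close> is therefore its preimage \<open>inv \<sigma> (x1, x2)\<close>.
\<close>

type_synonym labeling = "level \<Rightarrow> bool \<times> bool"

fun gray :: labeling where
  "gray A0 = (True, True)"
| "gray A1 = (True, False)"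
| "gray A2 = (False, False)"
| "gray A3 = (False, True)"

fun natural_order :: labeling where
  "natural_order A0 = (True, True)"
| "natural_order A1 = (True, False)"
| "natural_order A2 = (False, True)"
| "natural_order A3 = (False, False)"

fun even_odd :: labeling where
  "even_odd A0 = (True, True)"
| "even_odd A1 = (False, False)"
| "even_odd A2 = (False, True)"
| "even_odd A3 = (True, False)"

lemma bij_labelings: "bij gray" "bij natural_order" "bij even_odd"
proof -
  have "inj gray" "inj natural_order" "inj even_odd"
    unfolding inj_def by (auto elim!: gray.elims natural_order.elims even_odd.elims)
  moreover have "surj gray" "surj natural_order" "surj even_odd"
    unfolding surj_def by (auto simp: all_bool_eq intro: gray.simps[symmetric]
        natural_order.simps[symmetric] even_odd.simps[symmetric])
  ultimately show "bij gray" "bij natural_order" "bij even_odd"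
    by (auto simp: bij_def)
qed

type_synonym channel = "level \<Rightarrow> symbol pmf"

text \<open>\<^term>\<open>case_symbol p0 p1 p2 p3\<close> is the row with entries \<open>p0, p1, p2, p3\<close>.\<close>

fun mlc_matrix :: "real \<Rightarrow> real \<Rightarrow> real \<Rightarrow> real \<Rightarrow> level \<Rightarrow> symbol \<Rightarrow> real" where
  "mlc_matrix a1 a2 b1 c1 A0 = case_symbol a1 a2 0 (1 - a1 - a2)"
| "mlc_matrix a1 a2 b1 c1 A1 = case_symbol 0 b1 (1 - b1) 0"
| "mlc_matrix a1 a2 b1 c1 A2 = case_symbol 0 0 c1 (1 - c1)"
| "mlc_matrix a1 a2 b1 c1 A3 = case_symbol 0 0 0 1"

definition mlc_channel :: "real \<Rightarrow> real \<Rightarrow> real \<Rightarrow> real \<Rightarrow> channel" where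
  "mlc_channel a1 a2 b1 c1 v = embed_pmf (mlc_matrix a1 a2 b1 c1 v)"

lemma pmf_mlc_channel:
  assumes "0 \<le> a1" "0 \<le> a2" "a1 + a2 \<le> 1" "b1 \<in> {0..1}" "c1 \<in> {0..1}"
  shows "pmf (mlc_channel a1 a2 b1 c1 v) s = mlc_matrix a1 a2 b1 c1 v s"
proof -
  have nonneg: "0 \<le> mlc_matrix a1 a2 b1 c1 v y" for y
    using assms by (cases v; cases y) auto
  have "(\<integral>\<^sup>+y. ennreal (mlc_matrix a1 a2 b1 c1 v y) \<partial>count_space UNIV)
      = (\<Sum>y\<in>UNIV. ennreal (mlc_matrix a1 a2 b1 c1 v y))"
    by (rule nn_integral_count_space_finite) (simp add: UNIV_symbol)
  also have "\<dots> = ennreal (\<Sum>y\<in>UNIV. mlc_matrix a1 a2 b1 c1 v y)"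
    using nonneg by (intro sum_ennreal) auto
  also have "\<dots> = 1"
    by (cases v) (auto simp: UNIV_symbol)
  finally show ?thesis
    unfolding mlc_channel_def by (intro pmf_embed_pmf nonneg)
qed

text \<open>Joint law of \<open>(X1, X2, Y)\<close>.\<close>

definition joint :: "channel \<Rightarrow> labeling \<Rightarrow> (bool \<times> bool \<times> symbol) pmf" where
  "joint W \<sigma> =
     bind_pmf (pmf_of_set UNIV) (\<lambda>x1.
     bind_pmf (pmf_of_set UNIV) (\<lambda>x2.
     map_pmf (\<lambda>y. (x1, x2, y)) (W (inv \<sigma> (x1, x2)))))"

definition X1 :: "bool \<times> bool \<times> symbol \<Rightarrow> bool" where
  "X1 = (\<lambda>(x1, x2, y). x1)"

definition X2 :: "bool \<times> bool \<times> symbol \<Rightarrow> bool" where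
  "X2 = (\<lambda>(x1, x2, y). x2)"

definition Y :: "bool \<times> bool \<times> symbol \<Rightarrow> symbol" where
  "Y = (\<lambda>(x1, x2, y). y)"

definition mutual_info :: "'w pmf \<Rightarrow> ('w \<Rightarrow> 'a) \<Rightarrow> ('w \<Rightarrow> 'b) \<Rightarrow> real" where
  "mutual_info p U V =
     prob_space.mutual_information (measure_pmf p) 2 (count_space UNIV) (count_space UNIV) U V"

text \<open>The library defines \<open>I(U; V | Z)\<close> by the chain rule, as \<open>I(U; (V, Z)) - I(U; Z)\<close>.\<close>

definition cond_mutual_info ::
  "'w pmf \<Rightarrow> ('w \<Rightarrow> 'a) \<Rightarrow> ('w \<Rightarrow> 'b) \<Rightarrow> ('w \<Rightarrow> 'c) \<Rightarrow> real" where
  "cond_mutual_info p U V Z =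
     prob_space.conditional_mutual_information (measure_pmf p) 2
       (count_space UNIV) (count_space UNIV) (count_space UNIV) U V Z"

definition region_TIN :: "channel \<Rightarrow> labeling \<Rightarrow> (real \<times> real) set" where
  "region_TIN W \<sigma> = {(R1, R2).
     0 \<le> R1 \<and> R1 \<le> mutual_info (joint W \<sigma>) X1 Y \<and>
     0 \<le> R2 \<and> R2 \<le> mutual_info (joint W \<sigma>) X2 Y}"

definition sum_rate_TIN :: "channel \<Rightarrow> labeling \<Rightarrow> real" where
  "sum_rate_TIN W \<sigma> = mutual_info (joint W \<sigma>) X1 Y + mutual_info (joint W \<sigma>) X2 Y"

definition region_SC :: "channel \<Rightarrow> labeling \<Rightarrow> (real \<times> real) set" where
  "region_SC W \<sigma> = {(R1, R2).
     0 \<le> R1 \<and> 0 \<le> R2 \<and>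
     R1 \<le> cond_mutual_info (joint W \<sigma>) X1 Y X2 \<and>
     R2 \<le> cond_mutual_info (joint W \<sigma>) X2 Y X1 \<and>
     R1 + R2 \<le> mutual_info (joint W \<sigma>) (\<lambda>\<omega>. (X1 \<omega>, X2 \<omega>)) Y}"

definition sum_rate_SC :: "channel \<Rightarrow> labeling \<Rightarrow> real" where
  "sum_rate_SC W \<sigma> = mutual_info (joint W \<sigma>) (\<lambda>\<omega>. (X1 \<omega>, X2 \<omega>)) Y"

datatype symbol1 = S01 | S23

datatype symbol2 = T0 | T12 | T3

fun merge1 :: "symbol \<Rightarrow> symbol1" where
  "merge1 S0 = S01"
| "merge1 S1 = S01"
| "merge1 S2 = S23"
| "merge1 S3 = S23"

fun merge2 :: "symbol \<Rightarrow> symbol2" where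
  "merge2 S0 = T0"
| "merge2 S1 = T12"
| "merge2 S2 = T12"
| "merge2 S3 = T3"

definition region_DS :: "channel \<Rightarrow> labeling \<Rightarrow> (real \<times> real) set" where
  "region_DS W \<sigma> = {(R1, R2).
     0 \<le> R1 \<and> R1 \<le> mutual_info (joint W \<sigma>) X1 (merge1 \<circ> Y) \<and>
     0 \<le> R2 \<and> R2 \<le> mutual_info (joint W \<sigma>) X2 (merge2 \<circ> Y)}"

definition sum_rate_DS :: "channel \<Rightarrow> labeling \<Rightarrow> real" where
  "sum_rate_DS W \<sigma> =
     mutual_info (joint W \<sigma>) X1 (merge1 \<circ> Y) + mutual_info (joint W \<sigma>) X2 (merge2 \<circ> Y)"

end

theory Submission
  imports Defs
begin

text \<open>
  Each labeling splits the four levels into two pairs in two ways, once per input bit, and each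
  single-user mutual information depends only on the pairing. The three pairings of the levels are
  \<open>P = {A0,A1 | A2,A3}\<close>, \<open>Q = {A0,A3 | A1,A2}\<close> and \<open>S = {A0,A2 | A1,A3}\<close>;
  the Gray, natural-order and even-odd labelings use \<open>(P,Q)\<close>, \<open>(P,S)\<close> and \<open>(Q,S)\<close>.
  Everything then reduces to \<open>I\<^sub>P > I\<^sub>S\<close> and \<open>I\<^sub>Q > I\<^sub>S\<close>, compared output by output: an output \<open>y\<close>
  reached with weights \<open>u\<close>, \<open>v\<close> from the two pairs contributes a function of \<open>(u, v)\<close> that,
  for fixed \<open>u + v\<close>, strictly increases with \<open>\<bar>u - v\<bar>\<close>, and is subadditive, which
  makes merging outputs a loss. Both properties come from Gibbs' inequality. The successive
  cancellation bounds follow from the chain rule, and \<open>I(X1,X2;Y)\<close> does not depend on the labeling.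
\<close>

instance level :: finite
  by standard (simp add: UNIV_level)

instance symbol :: finite
  by standard (simp add: UNIV_symbol)

lemma UNIV_symbol1: "UNIV = {S01, S23}"
  using symbol1.exhaust by blast

lemma UNIV_symbol2: "UNIV = {T0, T12, T3}"
  using symbol2.exhaust by blast

instance symbol1 :: finite
  by standard (simp add: UNIV_symbol1)

instance symbol2 :: finite
  by standard (simp add: UNIV_symbol2)


section \<open>Mutual information on finite types\<close>

definition pmf_entropy :: "'a::finite pmf \<Rightarrow> real" where
  "pmf_entropy q = - (\<Sum>x\<in>UNIV. pmf q x * log 2 (pmf q x))"

lemma information_space_pmf: "information_space (measure_pmf p) 2"
  by unfold_locales auto

lemma distributed_map_pmf:
  "distributed (measure_pmf p) (count_space UNIV) U (pmf (map_pmf U p))"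
  unfolding distributed_def
  by (simp add: map_pmf_rep_eq[symmetric]) (rule measure_pmf_eq_density)

lemma pair_count_space_UNIV:
  "count_space (UNIV :: 'a::finite set) \<Otimes>\<^sub>M count_space (UNIV :: 'b::finite set) = count_space UNIV"
  by (simp add: pair_measure_count_space)

lemma entropy_eq_pmf_entropy:
  fixes U :: "'w \<Rightarrow> 'a::finite"
  shows "prob_space.entropy (measure_pmf p) 2 (count_space UNIV) U = pmf_entropy (map_pmf U p)"
proof -
  interpret information_space "measure_pmf p" 2 by (rule information_space_pmf)
  show ?thesis
    by (subst entropy_distr[OF distributed_map_pmf])
      (simp_all add: pmf_entropy_def lebesgue_integral_count_space_finite)
qed

text \<open>Turns the measure-theoretic definition into finite sums. In this three-entropy form,
  later identities only need entropy to be invariant under injective maps.\<close>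

lemma mutual_info_eq_pmf_entropy:
  fixes U :: "'w \<Rightarrow> 'a::finite" and V :: "'w \<Rightarrow> 'b::finite"
  shows "mutual_info p U V = pmf_entropy (map_pmf U p) + pmf_entropy (map_pmf V p)
           - pmf_entropy (map_pmf (\<lambda>w. (U w, V w)) p)"
proof -
  interpret information_space "measure_pmf p" 2 by (rule information_space_pmf)
  show ?thesis
    unfolding mutual_info_def
    by (subst mutual_information_eq_entropy_conditional_entropy_distr
          [OF _ _ distributed_map_pmf _ distributed_map_pmf _
            distributed_map_pmf[of p "\<lambda>w. (U w, V w)", folded pair_count_space_UNIV]])
      (auto simp: pair_count_space_UNIV entropy_eq_pmf_entropy integrable_count_space
        sigma_finite_measure_count_space_finite)
qed

lemma pmf_entropy_map_inj:
  fixes f :: "'a::finite \<Rightarrow> 'b::finite"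
  assumes "inj f"
  shows "pmf_entropy (map_pmf f q) = pmf_entropy q"
proof -
  have "(\<Sum>x\<in>UNIV. pmf (map_pmf f q) x * log 2 (pmf (map_pmf f q) x))
      = (\<Sum>x\<in>range f. pmf (map_pmf f q) x * log 2 (pmf (map_pmf f q) x))"
    by (rule sum.mono_neutral_right) (auto intro!: pmf_map_outside)
  also have "\<dots> = (\<Sum>x\<in>UNIV. pmf q x * log 2 (pmf q x))"
    using assms by (simp add: sum.reindex pmf_map_inj')
  finally show ?thesis
    by (simp add: pmf_entropy_def)
qed

lemma mutual_info_comp_inj:
  fixes U :: "'w \<Rightarrow> 'a::finite" and V :: "'w \<Rightarrow> 'b::finite" and f :: "'a \<Rightarrow> 'c::finite"
  assumes "inj f"
  shows "mutual_info p (f \<circ> U) V = mutual_info p U V"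
proof -
  have "inj (map_prod f (id :: 'b \<Rightarrow> 'b))"
    using assms by (simp add: prod.inj_map)
  from pmf_entropy_map_inj[OF this, of "map_pmf (\<lambda>w. (U w, V w)) p"]
    pmf_entropy_map_inj[OF assms, of "map_pmf U p"]
  show ?thesis
    by (simp add: mutual_info_eq_pmf_entropy pmf.map_comp comp_def)
qed

lemma cond_mutual_info_eq_diff:
  fixes U :: "'w \<Rightarrow> 'a::finite" and V :: "'w \<Rightarrow> 'b::finite" and Z :: "'w \<Rightarrow> 'c::finite"
  shows "cond_mutual_info p U V Z = mutual_info p U (\<lambda>w. (V w, Z w)) - mutual_info p U Z"
  unfolding cond_mutual_info_def mutual_info_def
    prob_space.conditional_mutual_information_def[OF prob_space_measure_pmf]
  by (simp add: pair_count_space_UNIV)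

text \<open>Expanded into entropies, the two sides differ only in the order of tuple components:
  \<open>(U, Z), V\<close> against \<open>U, V, Z\<close>, and \<open>Z, V\<close> against
  \<open>V, Z\<close>.\<close>

lemma cond_mutual_info_chain_rule:
  fixes U :: "'w \<Rightarrow> 'a::finite" and V :: "'w \<Rightarrow> 'b::finite" and Z :: "'w \<Rightarrow> 'c::finite"
  shows "cond_mutual_info p U V Z = mutual_info p (\<lambda>w. (U w, Z w)) V - mutual_info p Z V"
proof -
  have "inj (\<lambda>(u, v, z). ((u :: 'a, z :: 'c), v :: 'b))"
    by (auto simp: inj_def)
  from pmf_entropy_map_inj[OF this, of "map_pmf (\<lambda>w. (U w, V w, Z w)) p"]
  have uvz: "pmf_entropy (map_pmf (\<lambda>w. ((U w, Z w), V w)) p)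
      = pmf_entropy (map_pmf (\<lambda>w. (U w, V w, Z w)) p)"
    by (simp add: pmf.map_comp comp_def)
  from pmf_entropy_map_inj[OF inj_swap, of "map_pmf (\<lambda>w. (V w, Z w)) p"]
  have vz: "pmf_entropy (map_pmf (\<lambda>w. (Z w, V w)) p) = pmf_entropy (map_pmf (\<lambda>w. (V w, Z w)) p)"
    by (simp add: pmf.map_comp comp_def)
  show ?thesis
    by (simp add: cond_mutual_info_eq_diff mutual_info_eq_pmf_entropy uvz vz)
qed


section \<open>Contribution of one output to the information about a uniform bit\<close>

text \<open>For nonnegative weights with \<open>u + v > 0\<close> this is
  \<open>(u + v) * (1 - h (u / (u + v)))\<close>, where \<open>h\<close> is the binary entropy in
  bits. Written with terms x log x, it takes the right limit values at zero weights without a case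
  split.\<close>

definition bit_info :: "real \<Rightarrow> real \<Rightarrow> real" where
  "bit_info u v = u * log 2 u + v * log 2 v - (u + v) * log 2 (u + v) + (u + v)"

lemma pmf_map_finite:
  fixes p :: "'w::finite pmf"
  shows "pmf (map_pmf g p) z = (\<Sum>w\<in>UNIV. if g w = z then pmf p w else 0)"
proof -
  have "pmf (map_pmf g p) z = sum (pmf p) (g -` {z})"
    by (simp add: pmf_map measure_measure_pmf_finite)
  also have "\<dots> = (\<Sum>w\<in>UNIV. if g w = z then pmf p w else 0)"
    by (subst sum.inter_filter[symmetric]) (auto intro!: sum.cong)
  finally show ?thesis .
qed

lemma pmf_map_fst_finite:
  fixes q :: "('a::finite \<times> 'b::finite) pmf"
  shows "pmf (map_pmf fst q) x = (\<Sum>y\<in>UNIV. pmf q (x, y))"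
proof -
  have "pmf (map_pmf fst q) x = (\<Sum>a\<in>UNIV. \<Sum>y\<in>UNIV. if a = x then pmf q (a, y) else 0)"
    by (simp add: pmf_map_finite UNIV_Times_UNIV[symmetric] sum.cartesian_product split_beta
        del: UNIV_Times_UNIV) (auto intro!: sum.cong)
  also have "\<dots> = (\<Sum>a\<in>UNIV. if a = x then \<Sum>y\<in>UNIV. pmf q (a, y) else 0)"
    by (intro sum.cong) auto
  finally show ?thesis
    by simp
qed

lemma pmf_map_snd_finite:
  fixes q :: "('a::finite \<times> 'b::finite) pmf"
  shows "pmf (map_pmf snd q) y = (\<Sum>x\<in>UNIV. pmf q (x, y))"
proof -
  have "map_pmf snd q = map_pmf fst (map_pmf prod.swap q)"
    by (simp add: pmf.map_comp comp_def)
  then have "pmf (map_pmf snd q) y = (\<Sum>x\<in>UNIV. pmf (map_pmf prod.swap q) (prod.swap (x, y)))"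
    by (simp add: pmf_map_fst_finite)
  then show ?thesis
    by (simp only: pmf_map_inj'[OF inj_swap])
qed

text \<open>The entropy of \<open>U\<close> is one bit, and the masses of the outputs add up to 1
  (\<open>total\<close>). Sharing the bit out in proportion to mass gives the linear summand of
  \<open>bit_info\<close>.\<close>

lemma mutual_info_uniform_bit:
  fixes U :: "'w \<Rightarrow> bool" and V :: "'w \<Rightarrow> 'b::finite" and p :: "'w pmf"
  defines "q \<equiv> map_pmf (\<lambda>w. (U w, V w)) p"
  assumes unif: "map_pmf U p = pmf_of_set UNIV"
  shows "mutual_info p U V = (\<Sum>z\<in>UNIV. bit_info (pmf q (True, z)) (pmf q (False, z)))"
proof -
  let ?l = "\<lambda>t :: real. t * log 2 t"
  have U: "map_pmf U p = map_pmf fst q" and V: "map_pmf V p = map_pmf snd q"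
    by (simp_all add: q_def pmf.map_comp comp_def)
  have HU: "pmf_entropy (map_pmf U p) = 1"
    by (simp add: unif pmf_entropy_def UNIV_bool log_divide)
  have HV: "pmf_entropy (map_pmf V p)
      = - (\<Sum>z\<in>UNIV. ?l (pmf q (True, z) + pmf q (False, z)))"
    by (simp add: V pmf_entropy_def pmf_map_snd_finite UNIV_bool add.commute)
  have HUV: "pmf_entropy q
      = - (\<Sum>z\<in>UNIV. ?l (pmf q (True, z))) - (\<Sum>z\<in>UNIV. ?l (pmf q (False, z)))"
  proof -
    have "(\<Sum>w\<in>UNIV. ?l (pmf q w)) = (\<Sum>x\<in>UNIV. \<Sum>z\<in>UNIV. ?l (pmf q (x, z)))"
      by (simp add: UNIV_Times_UNIV[symmetric] sum.cartesian_product split_beta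
          del: UNIV_Times_UNIV)
    then show ?thesis
      by (simp add: pmf_entropy_def UNIV_bool)
  qed
  have total: "(\<Sum>z\<in>UNIV. pmf q (True, z)) + (\<Sum>z\<in>UNIV. pmf q (False, z)) = 1"
    unfolding pmf_map_fst_finite[symmetric] U[symmetric] unif by simp
  show ?thesis
    using total
    by (simp add: mutual_info_eq_pmf_entropy HU HV HUV bit_info_def sum.distrib sum_subtractf
        flip: q_def)
qed

section \<open>Homogeneity, supporting hyperplanes and comparison of output contributions\<close>

lemma bit_info_commute: "bit_info u v = bit_info v u"
  by (simp add: bit_info_def add.commute)

lemma bit_info_0 [simp]: "bit_info u 0 = u" "bit_info 0 u = u"
  by (simp_all add: bit_info_def)

lemma mult_log_scale:
  fixes c u :: real
  assumes "c > 0" "u \<ge> 0"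
  shows "(c * u) * log 2 (c * u) = c * (u * log 2 u) + c * u * log 2 c"
  using assms by (cases "u = 0") (auto simp: log_mult algebra_simps)

text \<open>Homogeneity of degree one, used to pull the input probability 1/4 out of every output's
  contribution.\<close>

lemma bit_info_scale:
  assumes "c > 0" "u \<ge> 0" "v \<ge> 0"
  shows "bit_info (c * u) (c * v) = c * bit_info u v"
  using mult_log_scale[of c u] mult_log_scale[of c v] mult_log_scale[of c "u + v"] assms
  by (simp add: bit_info_def distrib_left[symmetric]) (simp add: algebra_simps)

text \<open>This is \<open>ln t \<le> t - 1\<close> at \<open>t = m / u\<close>, multiplied by
  \<open>u\<close>, with equality only at \<open>t = 1\<close>. The case \<open>u = 0\<close> reads
  \<open>- m \<le> 0\<close>.\<close>

lemma mult_ln_tangent: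
  fixes u m :: real
  assumes "u \<ge> 0" "m > 0"
  shows "u - m \<le> u * ln u - u * ln m" and "u \<noteq> m \<Longrightarrow> u - m < u * ln u - u * ln m"
proof -
  have *: "u * ln u - u * ln m - (u - m) = u * (m / u - 1 - ln (m / u))" if "u > 0"
    using that assms by (simp add: ln_div field_simps)
  have **: "ln (m / u) \<le> m / u - 1" if "u > 0"
    using that assms by (intro ln_le_minus_one) auto
  show "u - m \<le> u * ln u - u * ln m"
  proof (cases "u = 0")
    case False
    with assms * ** have "u * ln u - u * ln m - (u - m) \<ge> 0"
      by simp
    then show ?thesis by simp
  qed (use assms in auto)
  show "u - m < u * ln u - u * ln m" if "u \<noteq> m"
  proof (cases "u = 0")
    case False
    then have "u > 0" using assms by simp
    have "ln (m / u) \<noteq> m / u - 1"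
      using ln_eq_minus_one[of "m / u"] assms \<open>u > 0\<close> that by auto
    then have "u * (m / u - 1 - ln (m / u)) > 0"
      using **[OF \<open>u > 0\<close>] \<open>u > 0\<close> by (intro mult_pos_pos) auto
    then show ?thesis using *[OF \<open>u > 0\<close>] by linarith
  qed (use assms in auto)
qed

text \<open>Equality holds at the distribution \<open>(r, s)\<close> proportional to \<open>(u, v)\<close>, so these
  linear functions of \<open>(u, v)\<close> are the supporting hyperplanes of \<^const>\<open>bit_info\<close>.\<close>

lemma bit_info_gibbs:
  assumes "u \<ge> 0" "v \<ge> 0" "r > 0" "s > 0" "r + s = 1"
  shows "u * log 2 (2 * r) + v * log 2 (2 * s) \<le> bit_info u v"
    and "u * s \<noteq> v * r \<Longrightarrow> u * log 2 (2 * r) + v * log 2 (2 * s) < bit_info u v"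
proof -
  define T where "T = u + v"
  have s: "s = 1 - r" using assms(5) by simp
  \<comment> \<open>Compare \<open>(u, v)\<close> with the same total \<open>T\<close> split in the
    ratio \<open>r : s\<close>. Each of the two terms is bounded below by the tangent inequality,
    and by \<open>sum\<close> these lower bounds cancel.\<close>
  have diff: "bit_info u v - (u * log 2 (2 * r) + v * log 2 (2 * s))
      = ((u * ln u - u * ln (r * T)) + (v * ln v - v * ln (s * T))) / ln 2" if "T > 0"
    using that assms
    by (simp add: bit_info_def log_def ln_mult field_simps T_def[symmetric])
       (simp add: T_def algebra_simps)
  have sum: "(u - r * T) + (v - s * T) = 0"
    by (simp add: T_def s algebra_simps)
  have le: "u * log 2 (2 * r) + v * log 2 (2 * s) \<le> bit_info u v" if "T > 0"
    using diff[OF that] mult_ln_tangent(1)[of u "r * T"] mult_ln_tangent(1)[of v "s * T"]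
      sum that assms by (smt (verit) divide_nonneg_pos ln_gt_zero mult_pos_pos)
  show "u * log 2 (2 * r) + v * log 2 (2 * s) \<le> bit_info u v"
  proof (cases "T > 0")
    case False
    then have "u = 0" "v = 0" using assms by (auto simp: T_def)
    then show ?thesis by simp
  qed (rule le)
  show "u * log 2 (2 * r) + v * log 2 (2 * s) < bit_info u v" if ne: "u * s \<noteq> v * r"
  proof -
    have "T > 0" using ne assms by (cases "u = 0"; cases "v = 0") (auto simp: T_def)
    have "u - r * T = u * s - v * r"
      by (simp add: T_def s algebra_simps)
    then have "u \<noteq> r * T" using ne by auto
    then show ?thesis
      using diff[OF \<open>T > 0\<close>] mult_ln_tangent(2)[of u "r * T"] mult_ln_tangent(1)[of v "s * T"]
        sum \<open>T > 0\<close> assms by (smt (verit) divide_pos_pos ln_gt_zero mult_pos_pos)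
  qed
qed

lemma bit_info_eq_supporting:
  assumes "u > 0" "v > 0"
  shows "bit_info u v = u * log 2 (2 * (u / (u + v))) + v * log 2 (2 * (v / (u + v)))"
  using assms by (simp add: bit_info_def log_mult log_divide) (simp add: algebra_simps)

lemma bit_info_nonneg:
  assumes "u \<ge> 0" "v \<ge> 0"
  shows "bit_info u v \<ge> 0"
  using bit_info_gibbs(1)[of u v "1/2" "1/2"] assms by simp

text \<open>The supporting hyperplane at the summed point is linear, agrees with
  \<open>bit_info\<close> there and lies below it at both summands. It is strictly below at the
  first one unless the two weight pairs are proportional.\<close>

lemma bit_info_subadditive:
  assumes "u1 \<ge> 0" "v1 \<ge> 0" "u2 \<ge> 0" "v2 \<ge> 0" "u1 + u2 > 0" "v1 + v2 > 0"
  shows "bit_info (u1 + u2) (v1 + v2) \<le> bit_info u1 v1 + bit_info u2 v2"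
    and "u1 * v2 \<noteq> u2 * v1 \<Longrightarrow> bit_info (u1 + u2) (v1 + v2) < bit_info u1 v1 + bit_info u2 v2"
proof -
  define T where "T = u1 + u2 + (v1 + v2)"
  define r where "r = (u1 + u2) / T"
  define s where "s = (v1 + v2) / T"
  have rs: "r > 0" "s > 0" "r + s = 1" "T > 0"
    using assms by (auto simp: r_def s_def T_def add_divide_distrib[symmetric])
  have eq: "bit_info (u1 + u2) (v1 + v2)
      = (u1 * log 2 (2 * r) + v1 * log 2 (2 * s)) + (u2 * log 2 (2 * r) + v2 * log 2 (2 * s))"
    using bit_info_eq_supporting[OF assms(5,6)]
    by (simp add: r_def s_def T_def algebra_simps)
  note g = bit_info_gibbs[OF _ _ rs(1-3)]
  show "bit_info (u1 + u2) (v1 + v2) \<le> bit_info u1 v1 + bit_info u2 v2"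
    unfolding eq using g(1) assms by (intro add_mono) auto
  show "bit_info (u1 + u2) (v1 + v2) < bit_info u1 v1 + bit_info u2 v2" if "u1 * v2 \<noteq> u2 * v1"
  proof -
    have "u1 * s - v1 * r = (u1 * v2 - u2 * v1) / T"
      by (simp add: r_def s_def diff_divide_distrib[symmetric] algebra_simps)
    then have "u1 * s \<noteq> v1 * r"
      using that rs by auto
    then show ?thesis
      unfolding eq using g assms by (intro add_less_le_mono) auto
  qed
qed

text \<open>Moving mass from the smaller weight \<open>v\<close> to the larger weight
  \<open>u\<close> does not decrease the supporting function at \<open>(u, v)\<close>, because its
  slope in that direction is \<open>log 2 (2 * r) - log 2 (2 * s) \<ge> 0\<close>. Strictness comes
  from Gibbs' inequality at the new point.\<close>

lemma bit_info_less_of_ordered: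
  assumes "v' \<ge> 0" "v > v'" "u \<ge> v" "u + v = u' + v'"
  shows "bit_info u v < bit_info u' v'"
proof -
  define r where "r = u / (u + v)"
  define s where "s = v / (u + v)"
  have pos: "u > 0" "v > 0" "u' > u" using assms by linarith+
  then have rs: "r > 0" "s > 0" "r + s = 1" "s \<le> r"
    using assms by (auto simp: r_def s_def add_divide_distrib[symmetric] divide_right_mono)
  have "bit_info u v = u * log 2 (2 * r) + v * log 2 (2 * s)"
    using bit_info_eq_supporting[OF pos(1,2)] by (simp add: r_def s_def)
  also have "\<dots> = u' * log 2 (2 * r) + v' * log 2 (2 * s)
      - (u' - u) * (log 2 (2 * r) - log 2 (2 * s))"
  proof -
    have v: "v = v' + (u' - u)" using assms by linarith
    show ?thesis by (simp only: v) (simp add: algebra_simps)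
  qed
  also have "\<dots> \<le> u' * log 2 (2 * r) + v' * log 2 (2 * s)"
    using rs pos by simp
  also have "\<dots> < bit_info u' v'"
  proof (rule bit_info_gibbs(2))
    have "u' * s - v' * r = (u' * v - v' * u) / (u + v)"
      by (simp add: r_def s_def diff_divide_distrib)
    moreover have "v' * u < u' * v"
    proof -
      have "v' * u \<le> v' * u'" using assms pos by (intro mult_left_mono) auto
      also have "\<dots> < v * u'" using assms pos by (intro mult_strict_right_mono) auto
      finally show ?thesis by (simp add: mult.commute)
    qed
    ultimately show "u' * s \<noteq> v' * r" using pos by auto
  qed (use assms pos rs in auto)
  finally show ?thesis .
qed

lemma bit_info_less_of_diff:
  assumes "u' \<ge> 0" "v' \<ge> 0" "u + v = u' + v'" "\<bar>u - v\<bar> < \<bar>u' - v'\<bar>"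
  shows "bit_info u v < bit_info u' v'"
proof -
  have "bit_info (max u v) (min u v) < bit_info (max u' v') (min u' v')"
    using assms by (intro bit_info_less_of_ordered) (auto simp: max_def min_def)
  moreover have "bit_info (max x y) (min x y) = bit_info x y" for x y
    by (auto simp: max_def min_def bit_info_commute)
  ultimately show ?thesis by simp
qed


section \<open>Labelings\<close>

lemma pmf_joint:
  "pmf (joint W \<sigma>) (x1, x2, y) = pmf (W (inv \<sigma> (x1, x2))) y / 4"
proof -
  have "pmf (map_pmf (\<lambda>y. (b1, b2, y)) q) (x1, x2, y) = (if b1 = x1 \<and> b2 = x2 then pmf q y else 0)"
    for b1 b2 :: bool and q :: "symbol pmf"
  proof (cases "b1 = x1 \<and> b2 = x2")
    case True
    have "inj (\<lambda>y :: symbol. (x1, x2, y))" by (simp add: inj_def)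
    with True show ?thesis using pmf_map_inj'[of "\<lambda>y. (x1, x2, y)" q y] by simp
  qed (auto intro!: pmf_map_outside)
  then show ?thesis
    by (cases x1; cases x2) (simp_all add: joint_def pmf_bind integral_pmf_of_set UNIV_bool)
qed

lemma pmf_map_joint:
  "pmf (map_pmf g (joint W \<sigma>)) z
     = (\<Sum>x1\<in>UNIV. \<Sum>x2\<in>UNIV. \<Sum>y\<in>UNIV.
         if g (x1, x2, y) = z then pmf (W (inv \<sigma> (x1, x2))) y else 0) / 4"
proof -
  have "pmf (map_pmf g (joint W \<sigma>)) z
      = (\<Sum>x1\<in>UNIV. \<Sum>x2\<in>UNIV. \<Sum>y\<in>UNIV.
         if g (x1, x2, y) = z then pmf (joint W \<sigma>) (x1, x2, y) else 0)"
    by (simp add: pmf_map_finite UNIV_Times_UNIV[symmetric] sum.cartesian_product split_beta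
        del: UNIV_Times_UNIV cong: if_cong)
  then show ?thesis
    by (simp add: pmf_joint sum_divide_distrib if_distrib[of "\<lambda>t. t / 4"] cong: if_cong)
qed

lemma map_pmf_joint_bit:
  "map_pmf X1 (joint W \<sigma>) = pmf_of_set UNIV" "map_pmf X2 (joint W \<sigma>) = pmf_of_set UNIV"
proof -
  have "(\<Sum>y\<in>UNIV. pmf q y) = 1" for q :: "symbol pmf"
    by (rule sum_pmf_eq_1) auto
  then have "pmf (map_pmf X1 (joint W \<sigma>)) b = 1 / 2" "pmf (map_pmf X2 (joint W \<sigma>)) b = 1 / 2" for b
    by (cases b; simp add: pmf_map_joint X1_def X2_def UNIV_bool)+
  then show "map_pmf X1 (joint W \<sigma>) = pmf_of_set UNIV" "map_pmf X2 (joint W \<sigma>) = pmf_of_set UNIV"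
    by (auto intro!: pmf_eqI)
qed

lemma mutual_info_uniform_bit_nonneg:
  fixes U :: "'w \<Rightarrow> bool" and V :: "'w \<Rightarrow> 'b::finite"
  assumes "map_pmf U p = pmf_of_set UNIV"
  shows "mutual_info p U V \<ge> 0"
  unfolding mutual_info_uniform_bit[OF assms] by (intro sum_nonneg bit_info_nonneg) auto

lemma mutual_info_joint_bits:
  "mutual_info (joint W \<sigma>) X1 X2 = 0" "mutual_info (joint W \<sigma>) X2 X1 = 0"
proof -
  have "(\<Sum>y\<in>UNIV. pmf q y) = 1" for q :: "symbol pmf"
    by (rule sum_pmf_eq_1) auto
  then have q: "pmf (map_pmf (\<lambda>w. (X1 w, X2 w)) (joint W \<sigma>)) (b, b') = 1 / 4"
      "pmf (map_pmf (\<lambda>w. (X2 w, X1 w)) (joint W \<sigma>)) (b, b') = 1 / 4" for b b'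
    by (cases b; cases b'; simp add: pmf_map_joint X1_def X2_def UNIV_bool)+
  have "bit_info (1 / 4) (1 / 4) = 0"
    using log_pow_cancel[of 2 2] by (simp add: bit_info_def log_divide)
  then show "mutual_info (joint W \<sigma>) X1 X2 = 0" "mutual_info (joint W \<sigma>) X2 X1 = 0"
    by (simp_all add: mutual_info_uniform_bit map_pmf_joint_bit q)
qed

text \<open>The inputs are independent, so conditioning on one bit amounts to adjoining it to the
  output: I(X1;Y|X2) = I(X1;(Y,X2)), an unconditional information about a uniform bit.\<close>

lemma cond_mutual_info_joint_nonneg:
  "cond_mutual_info (joint W \<sigma>) X1 Y X2 \<ge> 0" "cond_mutual_info (joint W \<sigma>) X2 Y X1 \<ge> 0"
  by (simp_all add: cond_mutual_info_eq_diff mutual_info_joint_bits mutual_info_uniform_bit_nonneg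
      map_pmf_joint_bit)

text \<open>A general \<open>f\<close> covers both TIN (\<open>f = id\<close>) and the merged
  outputs of DS. Only the pairing of levels by the value of the bit matters.\<close>

lemma mutual_info_joint_X1:
  fixes f :: "symbol \<Rightarrow> 'b::finite"
  defines "w \<equiv> \<lambda>W v. pmf (map_pmf f (W v))"
  shows "mutual_info (joint W \<sigma>) X1 (f \<circ> Y)
    = (\<Sum>z\<in>UNIV. bit_info
        (w W (inv \<sigma> (True, True)) z + w W (inv \<sigma> (True, False)) z)
        (w W (inv \<sigma> (False, True)) z + w W (inv \<sigma> (False, False)) z)) / 4"
proof -
  let ?q = "map_pmf (\<lambda>\<omega>. (X1 \<omega>, (f \<circ> Y) \<omega>)) (joint W \<sigma>)"
  have q: "pmf ?q (b, z) = 1 / 4 * (w W (inv \<sigma> (b, True)) z + w W (inv \<sigma> (b, False)) z)" for b z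
    by (cases b) (simp_all add: pmf_map_joint w_def pmf_map_finite[of f] X1_def Y_def UNIV_bool
        add.commute)
  have w: "w W v z \<ge> 0" for v z
    by (simp add: w_def)
  show ?thesis
    unfolding mutual_info_uniform_bit[OF map_pmf_joint_bit(1)] q
    by (subst bit_info_scale) (simp_all add: w sum_divide_distrib)
qed

lemma mutual_info_joint_X2:
  fixes f :: "symbol \<Rightarrow> 'b::finite"
  defines "w \<equiv> \<lambda>W v. pmf (map_pmf f (W v))"
  shows "mutual_info (joint W \<sigma>) X2 (f \<circ> Y)
    = (\<Sum>z\<in>UNIV. bit_info
        (w W (inv \<sigma> (True, True)) z + w W (inv \<sigma> (False, True)) z)
        (w W (inv \<sigma> (True, False)) z + w W (inv \<sigma> (False, False)) z)) / 4"
proof -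
  let ?q = "map_pmf (\<lambda>\<omega>. (X2 \<omega>, (f \<circ> Y) \<omega>)) (joint W \<sigma>)"
  have q: "pmf ?q (b, z) = 1 / 4 * (w W (inv \<sigma> (True, b)) z + w W (inv \<sigma> (False, b)) z)" for b z
    by (cases b) (simp_all add: pmf_map_joint w_def pmf_map_finite[of f] X2_def Y_def UNIV_bool
        add.commute)
  have w: "w W v z \<ge> 0" for v z
    by (simp add: w_def)
  show ?thesis
    unfolding mutual_info_uniform_bit[OF map_pmf_joint_bit(2)] q
    by (subst bit_info_scale) (simp_all add: w sum_divide_distrib)
qed

lemma mutual_info_map_pmf:
  fixes U :: "'w \<Rightarrow> 'a::finite" and V :: "'w \<Rightarrow> 'b::finite"
  shows "mutual_info (map_pmf g p) U V = mutual_info p (U \<circ> g) (V \<circ> g)"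
  by (simp add: mutual_info_eq_pmf_entropy pmf.map_comp comp_def)

lemma sum_rate_SC_relabel:
  assumes "bij \<sigma>" "bij \<tau>"
  shows "sum_rate_SC W \<sigma> = sum_rate_SC W \<tau>"
proof -
  \<comment> \<open>\<open>h\<close> sends an input pair under \<open>\<sigma>\<close> to the pair
    that \<open>\<tau>\<close> assigns to the same level; \<open>g\<close> applies it and keeps the
    output.\<close>
  define h where "h = \<tau> \<circ> inv \<sigma>"
  define g where "g = (\<lambda>(x1, x2, y :: symbol). (fst (h (x1, x2)), snd (h (x1, x2)), y))"
  have "bij h"
    using assms by (simp add: h_def bij_comp bij_imp_bij_inv)
  then have "inj h" by (rule bij_is_inj)
  have "inj g"
  proof (rule injI)
    fix v w :: "bool \<times> bool \<times> symbol"
    assume eq: "g v = g w"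
    obtain x1 x2 y where v: "v = (x1, x2, y)" by (cases v)
    obtain x1' x2' y' where w: "w = (x1', x2', y')" by (cases w)
    have "h (x1, x2) = h (x1', x2')" "y = y'"
      using eq unfolding v w g_def by (simp_all add: prod_eq_iff)
    from injD[OF \<open>inj h\<close> this(1)] this(2) show "v = w"
      by (simp add: v w)
  qed
  have comp_g: "(\<lambda>\<omega>. (X1 \<omega>, X2 \<omega>)) \<circ> g = h \<circ> (\<lambda>\<omega>. (X1 \<omega>, X2 \<omega>))" "Y \<circ> g = Y"
    by (auto simp: fun_eq_iff g_def X1_def X2_def Y_def)
  have "joint W \<tau> = map_pmf g (joint W \<sigma>)"
  proof (rule pmf_eqI)
    fix w :: "bool \<times> bool \<times> symbol"
    obtain x1 x2 y where w: "w = (x1, x2, y)" by (cases w)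
    obtain x1' x2' where x: "h (x1', x2') = (x1, x2)"
      using bij_is_surj[OF \<open>bij h\<close>] by (metis surjD surj_pair)
    have "inv \<tau> (x1, x2) = inv \<sigma> (x1', x2')"
      using assms x by (intro inv_f_eq bij_is_inj) (simp_all add: h_def)
    moreover have "w = g (x1', x2', y)"
      by (simp add: w g_def x)
    then have "pmf (map_pmf g (joint W \<sigma>)) w = pmf (joint W \<sigma>) (x1', x2', y)"
      by (simp only: pmf_map_inj'[OF \<open>inj g\<close>])
    ultimately show "pmf (joint W \<tau>) w = pmf (map_pmf g (joint W \<sigma>)) w"
      by (simp add: pmf_joint) (simp add: w pmf_joint)
  qed
  then have "sum_rate_SC W \<tau>
      = mutual_info (joint W \<sigma>) ((\<lambda>\<omega>. (X1 \<omega>, X2 \<omega>)) \<circ> g) (Y \<circ> g)"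
    by (simp add: sum_rate_SC_def mutual_info_map_pmf)
  also have "\<dots> = mutual_info (joint W \<sigma>) (h \<circ> (\<lambda>\<omega>. (X1 \<omega>, X2 \<omega>))) Y"
    by (simp only: comp_g)
  also have "\<dots> = sum_rate_SC W \<sigma>"
    by (simp add: mutual_info_comp_inj[OF \<open>inj h\<close>] sum_rate_SC_def)
  finally show ?thesis by simp
qed

text \<open>With the sum rate independent of the labeling, a larger single-user information of one
  bit means a smaller SC bound for the other. This is why the Gray and natural-order inclusions for
  TIN and SC point in opposite directions.\<close>

lemma cond_mutual_info_joint:
  "cond_mutual_info (joint W \<sigma>) X1 Y X2 = sum_rate_SC W \<sigma> - mutual_info (joint W \<sigma>) X2 Y"
  "cond_mutual_info (joint W \<sigma>) X2 Y X1 = sum_rate_SC W \<sigma> - mutual_info (joint W \<sigma>) X1 Y"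
proof -
  show "cond_mutual_info (joint W \<sigma>) X1 Y X2 = sum_rate_SC W \<sigma> - mutual_info (joint W \<sigma>) X2 Y"
    by (simp add: cond_mutual_info_chain_rule sum_rate_SC_def)
  show "cond_mutual_info (joint W \<sigma>) X2 Y X1 = sum_rate_SC W \<sigma> - mutual_info (joint W \<sigma>) X1 Y"
    using mutual_info_comp_inj[OF inj_swap, of "joint W \<sigma>" "\<lambda>\<omega>. (X1 \<omega>, X2 \<omega>)" Y]
    by (simp add: cond_mutual_info_chain_rule sum_rate_SC_def comp_def)
qed

section \<open>Evaluation on the given channel and comparison of the rate regions\<close>

lemma inv_labelings:
  "inv gray (True, True) = A0" "inv gray (True, False) = A1"
  "inv gray (False, False) = A2" "inv gray (False, True) = A3"
  "inv natural_order (True, True) = A0" "inv natural_order (True, False) = A1"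
  "inv natural_order (False, True) = A2" "inv natural_order (False, False) = A3"
  "inv even_odd (True, True) = A0" "inv even_odd (False, False) = A1"
  "inv even_odd (False, True) = A2" "inv even_odd (True, False) = A3"
  by (auto intro!: inv_f_eq bij_is_inj bij_labelings)

theorem theorem7:
  fixes a1 a2 b1 c1 :: real
  assumes "a1 > 0" and "a2 > 0" and "a1 + a2 < 1"
    and "b1 \<in> {0<..<1}" and "c1 \<in> {0<..<1}"
  shows "region_DS (mlc_channel a1 a2 b1 c1) gray \<subset> region_TIN (mlc_channel a1 a2 b1 c1) gray \<and>
    region_TIN (mlc_channel a1 a2 b1 c1) natural_order \<subset> region_TIN (mlc_channel a1 a2 b1 c1) gray \<and>
    region_SC (mlc_channel a1 a2 b1 c1) gray \<subset> region_SC (mlc_channel a1 a2 b1 c1) natural_order \<and>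
    sum_rate_TIN (mlc_channel a1 a2 b1 c1) gray > sum_rate_DS (mlc_channel a1 a2 b1 c1) gray \<and>
    sum_rate_TIN (mlc_channel a1 a2 b1 c1) gray > sum_rate_TIN (mlc_channel a1 a2 b1 c1) natural_order \<and>
    sum_rate_TIN (mlc_channel a1 a2 b1 c1) gray > sum_rate_TIN (mlc_channel a1 a2 b1 c1) even_odd \<and>
    sum_rate_SC (mlc_channel a1 a2 b1 c1) gray = sum_rate_SC (mlc_channel a1 a2 b1 c1) natural_order \<and>
    sum_rate_SC (mlc_channel a1 a2 b1 c1) natural_order = sum_rate_SC (mlc_channel a1 a2 b1 c1) even_odd"
proof -
  define W where "W = mlc_channel a1 a2 b1 c1"
  define d where "d = 1 - a1 - a2"
  \<comment> \<open>Informations of the pairings P, Q, S, one summand per output (\<open>IP\<close>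
    groups the first two as \<open>a1 + (a2 + b1)\<close>); an output reached from only one pair
    contributes its plain weight. \<open>JP\<close> and \<open>JQ\<close> are the values of P and Q
    after \<open>merge1\<close> and \<open>merge2\<close>.\<close>
  define IP where "IP = (a1 + (a2 + b1) + bit_info (1 - b1) c1 + bit_info d (2 - c1)) / 4"
  define IQ where "IQ = (a1 + bit_info a2 b1 + (1 - b1 + c1) + bit_info (d + 1) (1 - c1)) / 4"
  define IS where "IS = (a1 + bit_info a2 b1 + bit_info (1 - b1) c1 + bit_info (d + 1 - c1) 1) / 4"
  define JP where "JP = (a1 + a2 + b1 + bit_info (1 - b1 + d) 2) / 4"
  define JQ where "JQ = (a1 + bit_info a2 (1 + c1) + bit_info (d + 1) (1 - c1)) / 4"
  have bounds: "0 < a1" "0 < a2" "0 < d" "d < 1" "0 < b1" "b1 < 1" "0 < c1" "c1 < 1"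
    using assms by (auto simp: d_def)
  have pmf_W: "pmf (W v) s = mlc_matrix a1 a2 b1 c1 v s" for v s
    unfolding W_def using assms by (intro pmf_mlc_channel) auto
  note X1_Y = mutual_info_joint_X1[of W _ id, unfolded id_comp pmf.map_id]
  note X2_Y = mutual_info_joint_X2[of W _ id, unfolded id_comp pmf.map_id]
  have gray_TIN: "mutual_info (joint W gray) X1 Y = IP" "mutual_info (joint W gray) X2 Y = IQ"
    by (simp_all add: X1_Y X2_Y inv_labelings pmf_W UNIV_symbol IP_def IQ_def d_def bit_info_commute
        algebra_simps)
  have natural_TIN: "mutual_info (joint W natural_order) X1 Y = IP"
      "mutual_info (joint W natural_order) X2 Y = IS"
    by (simp_all add: X1_Y X2_Y inv_labelings pmf_W UNIV_symbol IP_def IS_def d_def bit_info_commute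
        algebra_simps)
  have even_odd_TIN: "mutual_info (joint W even_odd) X1 Y = IQ"
      "mutual_info (joint W even_odd) X2 Y = IS"
    by (simp_all add: X1_Y X2_Y inv_labelings pmf_W UNIV_symbol IQ_def IS_def d_def bit_info_commute
        algebra_simps)
  have gray_DS: "mutual_info (joint W gray) X1 (merge1 \<circ> Y) = JP"
      "mutual_info (joint W gray) X2 (merge2 \<circ> Y) = JQ"
    by (simp_all add: mutual_info_joint_X1 mutual_info_joint_X2 inv_labelings pmf_map_finite pmf_W
        UNIV_symbol UNIV_symbol1 UNIV_symbol2 JP_def JQ_def d_def bit_info_commute algebra_simps)

  \<comment> \<open>Only merging \<open>S2\<close> with \<open>S3\<close> can lose information here:
    \<open>S0\<close> and \<open>S1\<close> are both reached only from the pair A0, A1.\<close>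
  have "bit_info (1 - b1 + d) (c1 + (2 - c1)) \<le> bit_info (1 - b1) c1 + bit_info d (2 - c1)"
    using bounds by (intro bit_info_subadditive(1)) auto
  then have JP: "JP \<le> IP" by (simp add: JP_def IP_def)
  \<comment> \<open>Merging \<open>S1\<close> with \<open>S2\<close> is a strict loss: the pair A0,
    A3 reaches \<open>S1\<close> but never \<open>S2\<close>, so the weights are not
    proportional.\<close>
  have "bit_info (a2 + 0) (b1 + (1 - b1 + c1)) < bit_info a2 b1 + bit_info 0 (1 - b1 + c1)"
    using bounds by (intro bit_info_subadditive(2)) auto
  then have JQ: "JQ < IQ" by (simp add: JQ_def IQ_def)
  \<comment> \<open>P and S differ only at \<open>S1\<close> and \<open>S3\<close>. At
    \<open>S3\<close> the claim \<open>\<bar>d - c1\<bar> < 2 - c1 - d\<close> amounts to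
    \<open>d < 1\<close> and \<open>c1 < 1\<close>.\<close>
  have "bit_info a2 b1 < bit_info (a2 + b1) 0"
    using bounds by (intro bit_info_less_of_diff) auto
  moreover have "bit_info (d + 1 - c1) 1 < bit_info d (2 - c1)"
    using bounds by (intro bit_info_less_of_diff) auto
  ultimately have SP: "IS < IP" by (simp add: IS_def IP_def)
  \<comment> \<open>Q and S differ only at \<open>S2\<close> and \<open>S3\<close>. At
    \<open>S3\<close> the claim is \<open>\<bar>d - c1\<bar> < d + c1\<close>.\<close>
  have "bit_info (1 - b1) c1 < bit_info (1 - b1 + c1) 0"
    using bounds by (intro bit_info_less_of_diff) auto
  moreover have "bit_info (d + 1 - c1) 1 < bit_info (d + 1) (1 - c1)"
    using bounds by (intro bit_info_less_of_diff) auto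
  ultimately have SQ: "IS < IQ" by (simp add: IS_def IQ_def)
  have nonneg: "0 \<le> IS"
    using bounds by (simp add: IS_def bit_info_nonneg)

  define I where "I = sum_rate_SC W gray"
  have I: "IP \<le> I" "IS \<le> I"
    using cond_mutual_info_joint_nonneg[of W natural_order]
    unfolding cond_mutual_info_joint natural_TIN
    by (simp_all add: I_def sum_rate_SC_relabel[OF bij_labelings(2) bij_labelings(1)])
  have SC: "sum_rate_SC W natural_order = I" "sum_rate_SC W even_odd = I"
    unfolding I_def by (intro sum_rate_SC_relabel bij_labelings)+
  have "region_DS W gray \<subset> region_TIN W gray"
  proof
    show "region_DS W gray \<subseteq> region_TIN W gray"
      using JP JQ by (auto simp: region_DS_def region_TIN_def gray_DS gray_TIN)
    have "(0, IQ) \<in> region_TIN W gray" "(0, IQ) \<notin> region_DS W gray"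
      using JQ SP SQ nonneg by (auto simp: region_DS_def region_TIN_def gray_DS gray_TIN)
    then show "region_DS W gray \<noteq> region_TIN W gray" by blast
  qed
  moreover have "region_TIN W natural_order \<subset> region_TIN W gray"
  proof
    show "region_TIN W natural_order \<subseteq> region_TIN W gray"
      using SQ by (auto simp: region_TIN_def natural_TIN gray_TIN)
    have "(0, IQ) \<in> region_TIN W gray" "(0, IQ) \<notin> region_TIN W natural_order"
      using SP SQ nonneg by (auto simp: region_TIN_def natural_TIN gray_TIN)
    then show "region_TIN W natural_order \<noteq> region_TIN W gray" by blast
  qed
  moreover have "region_SC W gray \<subset> region_SC W natural_order"
  proof
    show "region_SC W gray \<subseteq> region_SC W natural_order"
      using SQ by (auto simp: region_SC_def cond_mutual_info_joint SC natural_TIN gray_TIN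
          I_def[symmetric] sum_rate_SC_def[symmetric])
    \<comment> \<open>The largest \<open>R1\<close> under natural order; Gray only allows
      \<open>I - IQ\<close>. Membership uses \<open>IS \<le> I\<close>, \<open>IP \<le> I\<close>
      and \<open>0 \<le> IS\<close>.\<close>
    have "(I - IS, 0) \<in> region_SC W natural_order" "(I - IS, 0) \<notin> region_SC W gray"
      using I SQ nonneg by (auto simp: region_SC_def cond_mutual_info_joint SC natural_TIN gray_TIN
          I_def[symmetric] sum_rate_SC_def[symmetric])
    then show "region_SC W gray \<noteq> region_SC W natural_order" by blast
  qed
  \<comment> \<open>The Gray TIN sum rate shares \<open>IP\<close> with natural order and
    \<open>IQ\<close> with even-odd, so the two comparisons are \<open>IS < IQ\<close> and
    \<open>IS < IP\<close>.\<close>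
  ultimately show ?thesis
    using JP JQ SP SQ SC
    by (simp add: sum_rate_TIN_def sum_rate_DS_def gray_TIN natural_TIN even_odd_TIN gray_DS I_def
        flip: W_def)
qed

end
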